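(* Let $K$ be a class of total computable numerical functions satisfying the following requirements. \begin{enumerate} \item $K$ contains the basic functions $\lambda x.0$, $s(x)=x+1$, $I^n_m(x_1,\dots,x_n)=x_m$ ($1\le m\le n$), and also $x+y$, $x\dot{-}y$, $x\cdot y$, $\left[\frac x2\right]$ and $[\sqrt x]$. \item $K$ has a computable universal function for all its unary functions, i.e. there is a computable sequence $\{\mathcal{F}_n\}_{n\in\omega}$ consisting of exactly all unary functions from $K$. \item There exists a computable function $H:\omega\to\omega$ such that for all $n\in\omega$, $\mathrm{im}(\mathcal{F}_{H(n)})=\{0\}\cup\{x+1\mid x\in W_n\}$, and moreover for all $i\in W_n$ the set $\mathcal{F}^{-1}_{H(n)}(i+1)$ is infinite. \item $K$ is closed under superposition and either under the standard bounded recursion scheme or under recursion scheme 2. \end{enumerate} Then the structure $\widetilde K=(\widetilde K,0,Q^3_+,Q^3_-)$ generated by $K$ does not have a computable presentation.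
   Context: $W_n$ is the domain of the $n$-th partial computable function $\varphi_n$ in the Kleene numbering; $x\dot{-}y=\max(x-y,0)$; $[\cdot]$ is the integer part. A sequence $\{\mathcal{F}_n\}$ is computable if $(n,x)\mapsto\mathcal{F}_n(x)$ is computable. Standard bounded recursion scheme: if $\alpha,g,\psi\in K$, $f(\bar x,0)=\alpha(\bar x)$, $f(\bar x,y)=\psi(\bar x,y,f(\bar x,y-1))$ for $y\ge1$, and $f(\bar x,y)\le g(\bar x,y)$ for all $\bar x, y$, then $f\in K$. Recursion scheme 2: if $\alpha,g,\psi\in K$, $f(\bar x,0)=\alpha(\bar x)$, $f(\bar x,y)=\psi(\bar x,y,f(\bar x,[\frac y2]))$ for $y\ge1$, and $f(\bar x,y)\le g(\bar x,y)$ for all $\bar x, y$, then $f\in K$. For a total $f:\omega\to\{0,1,2\}$ put $\overline f=\sum_{i=0}^\infty\frac{f(i)-1}{2^{i+1}}$. The set of reals generated by $K$ is $\widetilde K=\{m+\overline f\mid m\in\mathbb{Z},\ f\in K \text{ unary},\ \mathrm{im}(f)\subseteq\{0,1,2\}\}$. The structure $\widetilde K=(\widetilde K,0,Q^3_+,Q^3_-)$ has universe this set, the constant $0$, and the ternary relations $Q^3_+(x,y,z)\leftrightarrow x+y\le z$ and $Q^3_-(x,y,z)\leftrightarrow x+y\ge z$ (addition and order in $\mathbb{R}$). A computable presentation (copy) of a structure with universe $A$ is a surjection $\mu:\omega\to A$ with respect to which all relations and operations of the signature, including equality, are computable. *)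

theory Defs
  imports Complex_Main "HOL-Library.FuncSet" "HOL-Library.Nat_Bijection"
begin

section \<open>Partial computable functions\<close>

text \<open>
  Kleene's \<open>\<mu>\<close>-recursive functions. Terms carry no arity: on argument lists of any fixed
  length a term computes a partial recursive function of that many arguments, being undefined
  where it refers to a missing argument. The recursion variable of \<open>Prim\<close> and the search
  variable of \<open>Mu\<close> come first in the argument list.
\<close>

datatype recf =
    Zero
  | Succ
  | Proj nat
  | Comp recf "recf list"
  | Prim recf recf
  | Mu recf

fun run :: "recf \<Rightarrow> nat list \<Rightarrow> nat option" where
  "run Zero xs = Some 0"
| "run Succ xs = (case xs of [] \<Rightarrow> None | x # _ \<Rightarrow> Some (Suc x))"
| "run (Proj i) xs = (if i < length xs then Some (xs ! i) else None)"
| "run (Comp f gs) xs =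
     (if \<exists>g\<in>set gs. run g xs = None then None
      else run f (map (\<lambda>g. the (run g xs)) gs))"
| "run (Prim f g) xs =
     (case xs of
        [] \<Rightarrow> None
      | y # ys \<Rightarrow> rec_nat (run f ys) (\<lambda>z r. Option.bind r (\<lambda>v. run g (z # v # ys))) y)"
| "run (Mu f) xs =
     (if \<exists>y. run f (y # xs) = Some 0 \<and> (\<forall>z<y. run f (z # xs) \<noteq> None)
      then Some (LEAST y. run f (y # xs) = Some 0) else None)"

definition tuples :: "nat \<Rightarrow> nat list set" where
  "tuples n = {xs. length xs = n}"

definition computable :: "nat \<Rightarrow> (nat list \<Rightarrow> nat) \<Rightarrow> bool" where
  "computable n f \<longleftrightarrow> (\<exists>c. \<forall>xs\<in>tuples n. run c xs = Some (f xs))"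

definition decidable :: "nat \<Rightarrow> (nat list \<Rightarrow> bool) \<Rightarrow> bool" where
  "decidable n P \<longleftrightarrow> computable n (\<lambda>xs. if P xs then 1 else 0)"

fun code_of :: "recf \<Rightarrow> nat" where
  "code_of Zero = prod_encode (0, 0)"
| "code_of Succ = prod_encode (1, 0)"
| "code_of (Proj i) = prod_encode (2, i)"
| "code_of (Comp f gs) =
     prod_encode (3, prod_encode (code_of f, list_encode (map code_of gs)))"
| "code_of (Prim f g) = prod_encode (4, prod_encode (code_of f, code_of g))"
| "code_of (Mu f) = prod_encode (5, code_of f)"

lemma code_of_eq_iff: "code_of c = code_of d \<longleftrightarrow> c = d"
proof
  show "code_of c = code_of d \<Longrightarrow> c = d"
  proof (induction c arbitrary: d)
    case (Comp f gs)
    then obtain f' gs' where d: "d = Comp f' gs'"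
      and f: "code_of f = code_of f'" and gs: "map code_of gs = map code_of gs'"
      by (cases d) (auto simp: list_encode_eq)
    have "gs = gs'"
    proof (rule nth_equalityI)
      show len: "length gs = length gs'"
        using gs by (metis length_map)
      show "gs ! i = gs' ! i" if "i < length gs" for i
        using Comp.IH(2)[of "gs ! i" "gs' ! i"] gs len that
        by (metis nth_map nth_mem)
    qed
    with Comp.IH(1)[OF f] d show ?case by simp
  qed (case_tac d; auto)+
qed simp

text \<open>
  The Kleene numbering of the unary partial computable functions; numbers that are not the code
  of a term index the nowhere defined function.
\<close>

definition phi :: "nat \<Rightarrow> nat \<Rightarrow> nat option" where
  "phi n x = (if n \<in> range code_of then run (inv code_of n) [x] else None)"

definition W :: "nat \<Rightarrow> nat set" where
  "W n = {x. phi n x \<noteq> None}"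

section \<open>Classes of numerical functions\<close>

text \<open>
  Total \<open>n\<close>-ary functions are functions on lists of length \<open>n\<close>, with the value
  \<open>undefined\<close> on all other lists so that equality is equality of \<open>n\<close>-ary functions.
  A class is a family \<open>K\<close> with \<open>K n\<close> its set of \<open>n\<close>-ary members. Nullary functions
  (constants) are permitted but not required: \<open>K 0\<close> may be empty.
\<close>

definition nfun :: "nat \<Rightarrow> (nat list \<Rightarrow> nat) set" where
  "nfun n = tuples n \<rightarrow>\<^sub>E UNIV"

definition lift1 :: "(nat \<Rightarrow> nat) \<Rightarrow> nat list \<Rightarrow> nat" where
  "lift1 f = (\<lambda>xs\<in>tuples 1. f (xs ! 0))"

definition lift2 :: "(nat \<Rightarrow> nat \<Rightarrow> nat) \<Rightarrow> nat list \<Rightarrow> nat" where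
  "lift2 f = (\<lambda>xs\<in>tuples 2. f (xs ! 0) (xs ! 1))"

definition unary :: "(nat \<Rightarrow> (nat list \<Rightarrow> nat) set) \<Rightarrow> (nat \<Rightarrow> nat) set" where
  "unary K = {f. lift1 f \<in> K 1}"

definition computable_class :: "(nat \<Rightarrow> (nat list \<Rightarrow> nat) set) \<Rightarrow> bool" where
  "computable_class K \<longleftrightarrow> (\<forall>n. K n \<subseteq> nfun n \<and> (\<forall>f\<in>K n. computable n f))"

definition contains_basic :: "(nat \<Rightarrow> (nat list \<Rightarrow> nat) set) \<Rightarrow> bool" where
  "contains_basic K \<longleftrightarrow>
     lift1 (\<lambda>x. 0) \<in> K 1 \<and>
     lift1 (\<lambda>x. x + 1) \<in> K 1 \<and>
     (\<forall>n m. 1 \<le> m \<and> m \<le> n \<longrightarrow> (\<lambda>xs\<in>tuples n. xs ! (m - 1)) \<in> K n) \<and>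
     lift2 (\<lambda>x y. x + y) \<in> K 2 \<and>
     lift2 (\<lambda>x y. x - y) \<in> K 2 \<and>
     lift2 (\<lambda>x y. x * y) \<in> K 2 \<and>
     lift1 (\<lambda>x. x div 2) \<in> K 1 \<and>
     lift1 (\<lambda>x. nat \<lfloor>sqrt (real x)\<rfloor>) \<in> K 1"

definition closed_superposition :: "(nat \<Rightarrow> (nat list \<Rightarrow> nat) set) \<Rightarrow> bool" where
  "closed_superposition K \<longleftrightarrow>
     (\<forall>n h gs. h \<in> K (length gs) \<and> set gs \<subseteq> K n \<longrightarrow>
        (\<lambda>xs\<in>tuples n. h (map (\<lambda>g. g xs) gs)) \<in> K n)"

definition closed_bounded_rec :: "(nat \<Rightarrow> (nat list \<Rightarrow> nat) set) \<Rightarrow> bool" where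
  "closed_bounded_rec K \<longleftrightarrow>
     (\<forall>k \<alpha> g \<psi> f.
        \<alpha> \<in> K k \<and> g \<in> K (k + 1) \<and> \<psi> \<in> K (k + 2) \<and> f \<in> nfun (k + 1) \<and>
        (\<forall>xs\<in>tuples k. f (xs @ [0]) = \<alpha> xs) \<and>
        (\<forall>xs\<in>tuples k. \<forall>y\<ge>1. f (xs @ [y]) = \<psi> (xs @ [y, f (xs @ [y - 1])])) \<and>
        (\<forall>xs\<in>tuples k. \<forall>y. f (xs @ [y]) \<le> g (xs @ [y])) \<longrightarrow>
        f \<in> K (k + 1))"

definition closed_bounded_rec2 :: "(nat \<Rightarrow> (nat list \<Rightarrow> nat) set) \<Rightarrow> bool" where
  "closed_bounded_rec2 K \<longleftrightarrow>
     (\<forall>k \<alpha> g \<psi> f.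
        \<alpha> \<in> K k \<and> g \<in> K (k + 1) \<and> \<psi> \<in> K (k + 2) \<and> f \<in> nfun (k + 1) \<and>
        (\<forall>xs\<in>tuples k. f (xs @ [0]) = \<alpha> xs) \<and>
        (\<forall>xs\<in>tuples k. \<forall>y\<ge>1. f (xs @ [y]) = \<psi> (xs @ [y, f (xs @ [y div 2])])) \<and>
        (\<forall>xs\<in>tuples k. \<forall>y. f (xs @ [y]) \<le> g (xs @ [y])) \<longrightarrow>
        f \<in> K (k + 1))"

section \<open>Structures and computable presentations\<close>

text \<open>
  Structures of finite signature: each operation and relation is listed with its arity, and
  constants are operations of arity 0.
\<close>

record 'a fin_struct =
  universe :: "'a set"
  operations :: "(nat \<times> ('a list \<Rightarrow> 'a)) list"
  relations :: "(nat \<times> ('a list \<Rightarrow> bool)) list"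

definition computable_presentation :: "'a fin_struct \<Rightarrow> (nat \<Rightarrow> 'a) \<Rightarrow> bool" where
  "computable_presentation A \<mu> \<longleftrightarrow>
     range \<mu> = universe A \<and>
     decidable 2 (\<lambda>xs. \<mu> (xs ! 0) = \<mu> (xs ! 1)) \<and>
     (\<forall>(n, f)\<in>set (operations A).
        \<exists>g. computable n g \<and> (\<forall>xs\<in>tuples n. \<mu> (g xs) = f (map \<mu> xs))) \<and>
     (\<forall>(n, R)\<in>set (relations A). decidable n (\<lambda>xs. R (map \<mu> xs)))"

definition digits_real :: "(nat \<Rightarrow> nat) \<Rightarrow> real" where
  "digits_real f = (\<Sum>i. (real (f i) - 1) / 2 ^ (i + 1))"

definition generated_reals :: "(nat \<Rightarrow> (nat list \<Rightarrow> nat) set) \<Rightarrow> real set" where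
  "generated_reals K =
     {of_int m + digits_real f | m f. f \<in> unary K \<and> range f \<subseteq> {0, 1, 2}}"

definition real_struct :: "(nat \<Rightarrow> (nat list \<Rightarrow> nat) set) \<Rightarrow> real fin_struct" where
  "real_struct K =
     \<lparr>universe = generated_reals K,
      operations = [(0, \<lambda>xs. 0)],
      relations = [(3, \<lambda>xs. xs ! 0 + xs ! 1 \<le> xs ! 2),
                   (3, \<lambda>xs. xs ! 0 + xs ! 1 \<ge> xs ! 2)]\<rparr>"

end

theory Submission
  imports Defs
begin

text \<open>
  Suppose that \<open>\<mu>\<close> is a computable presentation. A real \<open>x\<close> generated by \<open>K\<close> is constructed that
  differs from every \<open>\<mu> n\<close>. All digits of \<open>x\<close> are \<open>1\<close> (signed value 0) or \<open>2\<close> (signed value 1), so a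
  partial sum only increases. To settle requirement \<open>n\<close> at the partial sum \<open>q\<close>, digits of signed
  value 0 are produced, which leaves \<open>q\<close> unchanged, until it has been verified that \<open>\<mu> n \<le> q\<close> or,
  for some \<open>k\<close>, that \<open>\<mu> n > q + 2 ^ -(k + 1)\<close>. One digit of signed value 1 at a position \<open>y > k\<close> then
  makes \<open>x\<close> larger than \<open>q\<close>, by at most \<open>2 ^ -y\<close>, and hence different from \<open>\<mu> n\<close> in either case.
  Waiting is harmless precisely because the comparison is with the real \<open>q\<close> itself, which does not
  change in the meantime, and comparisons are decidable in the presentation.

  The digits have to be a function in \<open>K\<close>, although the verification may be much harder than any
  function in \<open>K\<close>. The true facts of this kind are coded as a set of certificates, which is decidable
  (\<open>certificate_decidable\<close>) and thus equal to some \<open>W e\<close>, so that a function \<open>G\<close> in \<open>K\<close> lists every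
  certificate infinitely often. A recursion whose state codes the current requirement and partial
  sum watches \<open>G\<close> and reacts to a certificate only when its code is below the current time. This
  keeps the state below a polynomial in the time, and no certificate is missed, since each one
  recurs. The partial sum is represented in the state by a \<open>\<mu>\<close>-index and the position of the last
  digit of signed value 1; the certificate supplies the index for the next state.

  Both recursion schemes are covered by letting the state change at powers of two only: under either
  scheme, a bounded recursion on the bit length of the argument stays in \<open>K\<close> (\<open>bit_length_rec\<close>).
\<close>

section \<open>Computability\<close>

lemma computable_cong:
  "(\<And>xs. xs \<in> tuples n \<Longrightarrow> f xs = g xs) \<Longrightarrow> computable n f \<Longrightarrow> computable n g"
  unfolding computable_def by simp

lemma computable_comp:
  assumes h: "computable (length gs) h" and gs: "\<And>g. g \<in> set gs \<Longrightarrow> computable n g"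
  shows "computable n (\<lambda>xs. h (map (\<lambda>g. g xs) gs))"
proof -
  obtain d where d: "\<And>xs. length xs = length gs \<Longrightarrow> run d xs = Some (h xs)"
    using h unfolding computable_def tuples_def by auto
  have "\<forall>g\<in>set gs. \<exists>c. \<forall>xs\<in>tuples n. run c xs = Some (g xs)"
    using gs unfolding computable_def by blast
  then obtain c where c: "\<And>g xs. g \<in> set gs \<Longrightarrow> xs \<in> tuples n \<Longrightarrow> run (c g) xs = Some (g xs)"
    by metis
  have "run (Comp d (map c gs)) xs = Some (h (map (\<lambda>g. g xs) gs))" if xs: "xs \<in> tuples n" for xs
  proof -
    have eq: "map (\<lambda>g. the (run g xs)) (map c gs) = map (\<lambda>g. g xs) gs"
      using c xs by simp
    have "\<not> (\<exists>g\<in>set (map c gs). run g xs = None)"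
      using c xs by auto
    then show ?thesis
      using d[of "map (\<lambda>g. g xs) gs"] by (simp only: run.simps eq if_False length_map)
  qed
  then show ?thesis
    unfolding computable_def by blast
qed

lemma computable_comp1:
  assumes "computable 1 (\<lambda>xs. h (xs ! 0))" "computable n a"
  shows "computable n (\<lambda>xs. h (a xs))"
  using computable_comp[of "[a]" "\<lambda>xs. h (xs ! 0)" n] assms by simp

lemma computable_comp2:
  assumes "computable 2 (\<lambda>xs. h (xs ! 0) (xs ! 1))" "computable n a" "computable n b"
  shows "computable n (\<lambda>xs. h (a xs) (b xs))"
  using computable_comp[of "[a, b]" "\<lambda>xs. h (xs ! 0) (xs ! 1)" n] assms
  by (auto simp: numeral_2_eq_2)

lemma computable_proj: "i < n \<Longrightarrow> computable n (\<lambda>xs. xs ! i)"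
  unfolding computable_def tuples_def by (intro exI[of _ "Proj i"]) auto

lemma run_const: "run (((\<lambda>c. Comp Succ [c]) ^^ k) Zero) xs = Some k"
  by (induction k) auto

lemma computable_const: "computable n (\<lambda>_. k)"
  unfolding computable_def using run_const by blast

lemma decidable_comp3:
  assumes "decidable 3 (\<lambda>xs. R (xs ! 0) (xs ! 1) (xs ! 2))"
    and "computable n a" "computable n b" "computable n c"
  shows "decidable n (\<lambda>xs. R (a xs) (b xs) (c xs))"
  using computable_comp[of "[a, b, c]" "\<lambda>xs. if R (xs ! 0) (xs ! 1) (xs ! 2) then 1 else 0" n] assms
  unfolding decidable_def by (auto simp: numeral_3_eq_3 numeral_2_eq_2)

lemma decidable_not:
  assumes "decidable n P"
  shows "decidable n (\<lambda>xs. \<not> P xs)"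
proof -
  have "run (Prim (Comp Succ [Zero]) Zero) xs = Some (if xs ! 0 = 0 then 1 else 0)"
    if "xs \<in> tuples 1" for xs
  proof -
    obtain y where xs: "xs = [y]"
      using \<open>xs \<in> tuples 1\<close> unfolding tuples_def by (auto simp: length_Suc_conv)
    have "rec_nat (Some (Suc 0)) (\<lambda>z r. Option.bind r (\<lambda>v. Some 0)) y
            = Some (if y = 0 then Suc 0 else 0)"
      by (induction y) auto
    then show ?thesis
      unfolding xs by simp
  qed
  then have "computable 1 (\<lambda>xs. if xs ! 0 = 0 then 1 else 0)"
    unfolding computable_def by blast
  from computable_comp1[where h = "\<lambda>x. if x = 0 then 1 else 0", OF this assms[unfolded decidable_def]]
  show ?thesis
    unfolding decidable_def by (rule computable_cong[rotated]) simp
qed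

lemma decidable_conj:
  assumes "decidable n P" "decidable n Q"
  shows "decidable n (\<lambda>xs. P xs \<and> Q xs)"
proof -
  have "run (Prim Zero (Proj 2)) xs = Some (if xs ! 0 = 0 then 0 else xs ! 1)"
    if "xs \<in> tuples 2" for xs
  proof -
    obtain y w where xs: "xs = [y, w]"
      using \<open>xs \<in> tuples 2\<close> unfolding tuples_def by (auto simp: length_Suc_conv numeral_2_eq_2)
    have "rec_nat (Some 0) (\<lambda>z r. Option.bind r (\<lambda>v. Some w)) y = Some (if y = 0 then 0 else w)"
      by (induction y) auto
    then show ?thesis
      unfolding xs by simp
  qed
  then have "computable 2 (\<lambda>xs. if xs ! 0 = 0 then 0 else xs ! 1)"
    unfolding computable_def by blast
  from computable_comp2[where h = "\<lambda>x y. if x = 0 then 0 else y", OF this assms[unfolded decidable_def]]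
  show ?thesis
    unfolding decidable_def by (rule computable_cong[rotated]) simp
qed

lemma decidable_disj:
  assumes "decidable n P" "decidable n Q"
  shows "decidable n (\<lambda>xs. P xs \<or> Q xs)"
  using decidable_not[OF decidable_conj[OF decidable_not[OF assms(1)] decidable_not[OF assms(2)]]]
  by simp

text \<open>
  Iterated unbounded search: if every member of the sequence has an \<open>R\<close>-successor, the sequence
  that always moves to the least one is computable.
\<close>

lemma computable_iterated_search:
  assumes R: "decidable 2 (\<lambda>xs. R (xs ! 0) (xs ! 1))"
    and p0: "p 0 = c" and pS: "\<And>t. p (Suc t) = (LEAST i. R i (p t))"
    and ex: "\<And>t. \<exists>i. R i (p t)"
  shows "computable 1 (\<lambda>xs. p (xs ! 0))"
proof -
  obtain d where "\<And>xs. xs \<in> tuples 2 \<Longrightarrow> run d xs = Some (if \<not> R (xs ! 0) (xs ! 1) then 1 else 0)"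
    using decidable_not[OF R] unfolding decidable_def computable_def by blast
  then have d: "run d [i, v] = Some (if R i v then 0 else 1)" for i v
    by (simp add: tuples_def)
  have search: "run (Mu d) [p t] = Some (p (Suc t))" for t
    using ex[of t] by (auto simp: d pS)
  define step where "step = Comp (Mu d) [Proj 1]"
  have step: "run step [z, p t] = Some (p (Suc t))" for z t
    using search[of t] unfolding step_def by simp
  have "run (Prim (((\<lambda>c. Comp Succ [c]) ^^ c) Zero) step) [t] = Some (p t)" for t
  proof -
    have "rec_nat (Some c) (\<lambda>z r. Option.bind r (\<lambda>v. run step [z, v])) t = Some (p t)"
      by (induction t) (auto simp: p0 step)
    then show ?thesis
      by (simp add: run_const)
  qed
  moreover have "\<exists>t. xs = [t]" if "xs \<in> tuples 1" for xs
    using that unfolding tuples_def by (auto simp: length_Suc_conv)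
  ultimately show ?thesis
    unfolding computable_def by (metis nth_Cons_0)
qed

lemma decidable_imp_W:
  assumes "decidable 1 (\<lambda>xs. V (xs ! 0))"
  shows "\<exists>e. W e = {m. V m}"
proof -
  have "decidable 2 (\<lambda>xs. \<not> V (xs ! 1))"
    using computable_comp1[OF assms[unfolded decidable_def] computable_proj[of 1 2]]
    by (intro decidable_not) (simp add: decidable_def)
  then obtain d where "\<And>xs. xs \<in> tuples 2 \<Longrightarrow> run d xs = Some (if \<not> V (xs ! 1) then 1 else 0)"
    unfolding decidable_def computable_def by blast
  then have d: "run d [y, m] = Some (if V m then 0 else 1)" for y m
    by (simp add: tuples_def)
  have "inj code_of"
    by (simp add: inj_def code_of_eq_iff)
  then have "phi (code_of (Mu d)) m = run (Mu d) [m]" for m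
    unfolding phi_def by (simp del: code_of.simps run.simps)
  then have "W (code_of (Mu d)) = {m. V m}"
    unfolding W_def by (auto simp: d simp del: code_of.simps split: if_splits)
  then show ?thesis ..
qed

section \<open>A pairing function built from square roots\<close>

definition isqrt :: "nat \<Rightarrow> nat" where
  "isqrt x = nat \<lfloor>sqrt (real x)\<rfloor>"

text \<open>
  This pairing is injective but not onto. It is polynomially bounded, and its projections \<open>fst_of\<close> and
  \<open>snd_of\<close> are composed of subtraction, multiplication and integer square roots, because \<open>a + b\<close> is
  the integer square root of \<open>pair a b\<close>.
\<close>

definition pair :: "nat \<Rightarrow> nat \<Rightarrow> nat" where
  "pair a b = (a + b) * (a + b) + a"

definition fst_of :: "nat \<Rightarrow> nat" where
  "fst_of z = z - isqrt z * isqrt z"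

definition snd_of :: "nat \<Rightarrow> nat" where
  "snd_of z = isqrt z - fst_of z"

lemma isqrt_pair: "isqrt (pair a b) = a + b"
proof -
  have "real (a + b) \<le> sqrt (real (pair a b))"
    by (rule real_le_rsqrt) (simp add: pair_def power2_eq_square)
  moreover have "sqrt (real (pair a b)) < real (a + b) + 1"
    by (rule real_less_lsqrt) (auto simp: pair_def power2_eq_square algebra_simps)
  ultimately have "\<lfloor>sqrt (real (pair a b))\<rfloor> = int (a + b)"
    by (intro floor_unique) auto
  then show ?thesis
    unfolding isqrt_def by simp
qed

lemma fst_of_pair [simp]: "fst_of (pair a b) = a"
  unfolding fst_of_def isqrt_pair by (simp add: pair_def)

lemma snd_of_pair [simp]: "snd_of (pair a b) = b"
  unfolding snd_of_def fst_of_pair isqrt_pair by simp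

lemma fst_of_le: "fst_of z \<le> z"
  unfolding fst_of_def by simp

lemma snd_of_le: "snd_of z \<le> z"
proof -
  have "real z \<le> real (z * z)"
    by (rule of_nat_mono) (cases z; simp)
  then have "sqrt (real z) \<le> real z"
    by (intro real_le_lsqrt) (auto simp: power2_eq_square)
  then have "isqrt z \<le> z"
    unfolding isqrt_def by linarith
  then show ?thesis
    unfolding snd_of_def by simp
qed

lemma pair_mono: "a \<le> a' \<Longrightarrow> b \<le> b' \<Longrightarrow> pair a b \<le> pair a' b'"
  unfolding pair_def by (intro add_mono mult_mono) auto

section \<open>Classes closed under superposition\<close>

locale superposition_class =
  fixes K :: "nat \<Rightarrow> (nat list \<Rightarrow> nat) set"
  assumes basic: "contains_basic K" and superposition: "closed_superposition K"
begin

text \<open>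
  Membership of \<open>n\<close>-ary functions in the class, regardless of the values on lists of other lengths.
\<close>

definition member :: "nat \<Rightarrow> (nat list \<Rightarrow> nat) \<Rightarrow> bool" where
  "member n f \<longleftrightarrow> restrict f (tuples n) \<in> K n"

lemma unary_iff: "f \<in> unary K \<longleftrightarrow> member 1 (\<lambda>xs. f (xs ! 0))"
  unfolding unary_def member_def lift1_def by simp

lemma member_proj: "i < n \<Longrightarrow> member n (\<lambda>xs. xs ! i)"
proof -
  assume "i < n"
  then have "1 \<le> Suc i \<and> Suc i \<le> n"
    by simp
  then have "(\<lambda>xs\<in>tuples n. xs ! (Suc i - 1)) \<in> K n"
    using basic unfolding contains_basic_def by blast
  then show ?thesis
    unfolding member_def by simp
qed

lemma member_comp1:
  assumes "f \<in> unary K" "member n a"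
  shows "member n (\<lambda>xs. f (a xs))"
proof -
  have "lift1 f \<in> K (length [restrict a (tuples n)])" "set [restrict a (tuples n)] \<subseteq> K n"
    using assms unfolding unary_def member_def by auto
  then have "(\<lambda>xs\<in>tuples n. lift1 f (map (\<lambda>g. g xs) [restrict a (tuples n)])) \<in> K n"
    using superposition unfolding closed_superposition_def by blast
  moreover have "(\<lambda>xs\<in>tuples n. lift1 f (map (\<lambda>g. g xs) [restrict a (tuples n)]))
      = (\<lambda>xs\<in>tuples n. f (a xs))"
    by (rule ext) (simp add: restrict_def lift1_def tuples_def)
  ultimately show ?thesis
    unfolding member_def by simp
qed

lemma member_comp2:
  assumes h: "member 2 (\<lambda>xs. h (xs ! 0) (xs ! 1))" and "member n a" "member n b"
  shows "member n (\<lambda>xs. h (a xs) (b xs))"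
proof -
  let ?h = "\<lambda>xs\<in>tuples 2. h (xs ! 0) (xs ! 1)" and ?gs = "[restrict a (tuples n), restrict b (tuples n)]"
  have "?h \<in> K (length ?gs)" "set ?gs \<subseteq> K n"
    using assms unfolding member_def by (auto simp: numeral_2_eq_2)
  then have "(\<lambda>xs\<in>tuples n. ?h (map (\<lambda>g. g xs) ?gs)) \<in> K n"
    using superposition unfolding closed_superposition_def by blast
  moreover have "(\<lambda>xs\<in>tuples n. ?h (map (\<lambda>g. g xs) ?gs)) = (\<lambda>xs\<in>tuples n. h (a xs) (b xs))"
    by (rule ext) (simp add: restrict_def tuples_def)
  ultimately show ?thesis
    unfolding member_def by simp
qed

lemma member_add: "member n a \<Longrightarrow> member n b \<Longrightarrow> member n (\<lambda>xs. a xs + b xs)"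
  and member_diff: "member n a \<Longrightarrow> member n b \<Longrightarrow> member n (\<lambda>xs. a xs - b xs)"
  and member_mult: "member n a \<Longrightarrow> member n b \<Longrightarrow> member n (\<lambda>xs. a xs * b xs)"
  using member_comp2[where h = "(+)"] member_comp2[where h = "(-)"] member_comp2[where h = "(*)"] basic
  by (simp_all add: contains_basic_def member_def lift2_def)

lemma member_Suc: "member n a \<Longrightarrow> member n (\<lambda>xs. Suc (a xs))"
  using basic by (intro member_comp1[where f = Suc]) (auto simp: contains_basic_def unary_def)

lemma member_const:
  assumes "0 < n"
  shows "member n (\<lambda>_. c)"
proof (induction c)
  case 0
  have "(\<lambda>_. 0) \<in> unary K"
    using basic unfolding contains_basic_def unary_def by simp
  from member_comp1[OF this member_proj[OF assms]] show ?case .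
qed (rule member_Suc)

lemma member_isqrt: "member n a \<Longrightarrow> member n (\<lambda>xs. isqrt (a xs))"
  using basic
  by (intro member_comp1[where f = isqrt]) (auto simp: contains_basic_def unary_def isqrt_def[abs_def])

lemma member_pair: "member n a \<Longrightarrow> member n b \<Longrightarrow> member n (\<lambda>xs. pair (a xs) (b xs))"
  unfolding pair_def by (intro member_add member_mult)

lemma member_fst_of: "member n a \<Longrightarrow> member n (\<lambda>xs. fst_of (a xs))"
  unfolding fst_of_def by (intro member_diff member_mult member_isqrt)

lemma member_snd_of: "member n a \<Longrightarrow> member n (\<lambda>xs. snd_of (a xs))"
  unfolding snd_of_def by (intro member_diff member_fst_of member_isqrt)

lemma member_if_eq:
  assumes "0 < n" "member n a" "member n b" "member n c" "member n d"
  shows "member n (\<lambda>xs. if a xs = b xs then c xs else d xs)"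
proof -
  \<comment> \<open>\<open>e\<close> is the arithmetic characteristic function of \<open>a = b\<close>\<close>
  define e where "e = (\<lambda>xs. 1 - ((a xs - b xs) + (b xs - a xs)))"
  have e: "member n e"
    unfolding e_def using assms by (intro member_add member_diff member_const)
  have "member n (\<lambda>xs. e xs * c xs + (1 - e xs) * d xs)"
    using assms e by (intro member_add member_mult member_diff member_const)
  moreover have "(\<lambda>xs. e xs * c xs + (1 - e xs) * d xs) = (\<lambda>xs. if a xs = b xs then c xs else d xs)"
    unfolding e_def by (rule ext) auto
  ultimately show ?thesis
    by simp
qed

lemma member_if_le:
  assumes "0 < n" "member n a" "member n b" "member n c" "member n d"
  shows "member n (\<lambda>xs. if a xs \<le> b xs then c xs else d xs)"
proof -
  have "member n (\<lambda>xs. if a xs - b xs = 0 then c xs else d xs)"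
    using assms by (intro member_if_eq member_diff member_const)
  then show ?thesis
    by simp
qed

lemmas member_intros =
  member_if_eq member_if_le member_Suc member_add member_diff member_mult member_pair
  member_fst_of member_snd_of member_const member_proj

end

text \<open>
  In a class of computable functions the closure properties above also yield computability.
\<close>

lemma (in superposition_class) member_imp_computable:
  assumes "computable_class K" "member n f"
  shows "computable n f"
proof -
  have "computable n (restrict f (tuples n))"
    using assms unfolding computable_class_def member_def by blast
  then show ?thesis
    by (rule computable_cong[rotated]) simp
qed

section \<open>Recursion along bit lengths\<close>

text \<open>The number of binary digits of \<open>y\<close>, where 0 has none.\<close>

fun bit_length :: "nat \<Rightarrow> nat" where
  "bit_length y = (if y = 0 then 0 else Suc (bit_length (y div 2)))"

declare bit_length.simps [simp del]

lemma bit_length_0 [simp]: "bit_length 0 = 0"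
  by (simp add: bit_length.simps)

lemma bit_length_eqI: "2 ^ j \<le> y \<Longrightarrow> y < 2 ^ Suc j \<Longrightarrow> bit_length y = Suc j"
proof (induction j arbitrary: y)
  case 0
  then have "y = 1"
    by simp
  then show ?case
    by (simp add: bit_length.simps)
next
  case (Suc j)
  then have "bit_length (y div 2) = Suc j"
    by (intro Suc.IH) auto
  moreover have "y \<noteq> 0"
    using Suc.prems by (metis not_less_zero le_0_eq power_not_zero zero_neq_numeral)
  ultimately show ?case
    by (subst bit_length.simps) simp
qed

lemma bit_length_power: "bit_length (2 ^ j) = Suc j"
  by (rule bit_length_eqI) auto

lemma bit_length_pos:
  assumes "0 < y"
  obtains j where "2 ^ j \<le> y" "y < 2 ^ Suc j" "bit_length y = Suc j"
proof -
  from ex_power_ivl1[of 2 y] assms obtain j where "2 ^ j \<le> y" "y < 2 ^ (j + 1)"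
    by auto
  then show ?thesis
    using that bit_length_eqI by simp
qed

text \<open>The largest power of two that is at most \<open>y\<close>, or 0 if \<open>y = 0\<close>.\<close>

definition top_power :: "nat \<Rightarrow> nat" where
  "top_power y = (if y = 0 then 0 else 2 ^ (bit_length y - 1))"

lemma top_power_eqI: "2 ^ j \<le> y \<Longrightarrow> y < 2 ^ Suc j \<Longrightarrow> top_power y = 2 ^ j"
  unfolding top_power_def using bit_length_eqI[of j y]
  by (cases "y = 0") (simp_all del: power_Suc)

lemma top_power_le: "top_power y \<le> y"
proof (cases "y = 0")
  case False
  then have "0 < y"
    by simp
  then obtain j where "2 ^ j \<le> y" "y < 2 ^ Suc j"
    by (rule bit_length_pos)
  then show ?thesis
    by (simp add: top_power_eqI del: power_Suc)
qed (simp add: top_power_def)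

lemma top_power_halve: "0 < y \<Longrightarrow> top_power y = (if y \<le> 1 then 1 else 2 * top_power (y div 2))"
proof -
  assume "0 < y"
  then obtain j where j: "2 ^ j \<le> y" "y < 2 ^ Suc j" "bit_length y = Suc j"
    by (rule bit_length_pos)
  show ?thesis
  proof (cases j)
    case 0
    then show ?thesis
      using j by (simp add: top_power_eqI[of 0 y])
  next
    case (Suc i)
    have "y \<ge> 2"
      using order_trans[OF power_increasing[of 1 j "2 :: nat"] j(1)] Suc by simp
    moreover have "top_power (y div 2) = 2 ^ i"
      using j Suc by (intro top_power_eqI) auto
    ultimately show ?thesis
      using Suc j by (simp add: top_power_eqI[of j y])
  qed
qed

text \<open>Passing from \<open>y - 1\<close> to \<open>y\<close> changes the bit length exactly when \<open>y\<close> is a power of two.\<close>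

lemma predecessor_cases:
  assumes "0 < y"
  obtains (power) j where "y = 2 ^ j" "bit_length (y - 1) = j"
      "top_power y = y"
    | (other) "top_power y \<noteq> y" "bit_length (y - 1) = bit_length y" "top_power (y - 1) = top_power y"
      "y \<noteq> 1" "y \<noteq> 2 * top_power (y - 1)"
proof -
  obtain j where j: "2 ^ j \<le> y" "y < 2 ^ Suc j" "bit_length y = Suc j"
    using assms by (rule bit_length_pos)
  show ?thesis
  proof (cases "y = 2 ^ j")
    case True
    have "bit_length (y - 1) = j"
    proof (cases j)
      case (Suc i)
      have "(2::nat) ^ i > 0" by simp
      then show ?thesis
        unfolding Suc True by (intro bit_length_eqI) (simp_all del: zero_less_power)
    qed (simp add: True)
    then show ?thesis
      using power True j by (simp add: top_power_eqI)
  next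
    case False
    then have *: "2 ^ j \<le> y - 1" "y - 1 < 2 ^ Suc j"
      using j by auto
    have "(1::nat) \<le> 2 ^ j"
      by simp
    then show ?thesis
      using False j bit_length_eqI[OF *] top_power_eqI[OF *] top_power_eqI[OF j(1,2)]
      by (intro other) auto
  qed
qed

locale recursion_class = superposition_class +
  assumes recursion: "closed_bounded_rec K \<or> closed_bounded_rec2 K"
begin

text \<open>
  The schemes without parameters. A dummy parameter is carried along because the class need not
  contain nullary functions.
\<close>

lemma bounded_rec_unary:
  assumes rec: "closed_bounded_rec K" and \<psi>: "member 2 (\<lambda>xs. \<psi> (xs ! 0) (xs ! 1))"
    and g: "g \<in> unary K" and f: "\<And>y. y \<ge> 1 \<Longrightarrow> f y = \<psi> y (f (y - 1))" "\<And>y. f y \<le> g y"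
  shows "f \<in> unary K"
proof -
  let ?f = "\<lambda>xs\<in>tuples (1 + 1). f (xs ! 1)" and ?a = "\<lambda>xs\<in>tuples 1. f 0"
    and ?g = "\<lambda>xs\<in>tuples (1 + 1). g (xs ! 1)" and ?h = "\<lambda>xs\<in>tuples (1 + 2). \<psi> (xs ! 1) (xs ! 2)"
  have "member (1 + 2) (\<lambda>xs. \<psi> (xs ! 1) (xs ! 2))"
    by (rule member_comp2[where h = \<psi>, OF \<psi>]; rule member_proj) auto
  moreover have "member (1 + 1) (\<lambda>xs. g (xs ! 1))"
    by (rule member_comp1[OF g]; rule member_proj) auto
  moreover have "member 1 (\<lambda>xs. f 0)"
    by (rule member_const) auto
  moreover have "?f \<in> nfun (1 + 1)" "\<forall>xs\<in>tuples 1. ?f (xs @ [0]) = ?a xs"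
    "\<forall>xs\<in>tuples 1. \<forall>y\<ge>1. ?f (xs @ [y]) = ?h (xs @ [y, ?f (xs @ [y - 1])])"
    "\<forall>xs\<in>tuples 1. \<forall>y. ?f (xs @ [y]) \<le> ?g (xs @ [y])"
    using f by (simp_all add: tuples_def nfun_def nth_append)
  ultimately have "?f \<in> K (1 + 1)"
    unfolding member_def
    by (intro rec[unfolded closed_bounded_rec_def, rule_format, of ?a 1 ?g ?h ?f] conjI)
  then have "member 2 (\<lambda>xs. f (xs ! 1))"
    unfolding member_def by (simp add: numeral_2_eq_2)
  from member_comp2[where h = "\<lambda>x y. f y", OF this member_proj[of 0 1] member_proj[of 0 1]]
  show ?thesis
    unfolding unary_iff by simp
qed

lemma bounded_rec2_unary:
  assumes rec: "closed_bounded_rec2 K" and \<psi>: "member 2 (\<lambda>xs. \<psi> (xs ! 0) (xs ! 1))"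
    and g: "g \<in> unary K" and f: "\<And>y. y \<ge> 1 \<Longrightarrow> f y = \<psi> y (f (y div 2))" "\<And>y. f y \<le> g y"
  shows "f \<in> unary K"
proof -
  let ?f = "\<lambda>xs\<in>tuples (1 + 1). f (xs ! 1)" and ?a = "\<lambda>xs\<in>tuples 1. f 0"
    and ?g = "\<lambda>xs\<in>tuples (1 + 1). g (xs ! 1)" and ?h = "\<lambda>xs\<in>tuples (1 + 2). \<psi> (xs ! 1) (xs ! 2)"
  have "member (1 + 2) (\<lambda>xs. \<psi> (xs ! 1) (xs ! 2))"
    by (rule member_comp2[where h = \<psi>, OF \<psi>]; rule member_proj) auto
  moreover have "member (1 + 1) (\<lambda>xs. g (xs ! 1))"
    by (rule member_comp1[OF g]; rule member_proj) auto
  moreover have "member 1 (\<lambda>xs. f 0)"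
    by (rule member_const) auto
  moreover have "?f \<in> nfun (1 + 1)" "\<forall>xs\<in>tuples 1. ?f (xs @ [0]) = ?a xs"
    "\<forall>xs\<in>tuples 1. \<forall>y\<ge>1. ?f (xs @ [y]) = ?h (xs @ [y, ?f (xs @ [y div 2])])"
    "\<forall>xs\<in>tuples 1. \<forall>y. ?f (xs @ [y]) \<le> ?g (xs @ [y])"
    using f by (simp_all add: tuples_def nfun_def nth_append)
  ultimately have "?f \<in> K (1 + 1)"
    unfolding member_def
    by (intro rec[unfolded closed_bounded_rec2_def, rule_format, of ?a 1 ?g ?h ?f] conjI)
  then have "member 2 (\<lambda>xs. f (xs ! 1))"
    unfolding member_def by (simp add: numeral_2_eq_2)
  from member_comp2[where h = "\<lambda>x y. f y", OF this member_proj[of 0 1] member_proj[of 0 1]]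
  show ?thesis
    unfolding unary_iff by simp
qed

lemma top_power_in_class: "top_power \<in> unary K"
  using recursion
proof
  have id: "(\<lambda>y. y) \<in> unary K"
    unfolding unary_iff by (simp add: member_proj)
  show ?thesis if rec: "closed_bounded_rec K"
  proof (rule bounded_rec_unary[OF rec _ id _ top_power_le])
    show "member 2 (\<lambda>xs. if xs ! 0 \<le> 1 then 1 else if xs ! 0 = 2 * xs ! 1 then xs ! 0 else xs ! 1)"
      by (intro member_intros) auto
    show "top_power y = (if y \<le> 1 then 1 else if y = 2 * top_power (y - 1) then y else top_power (y - 1))"
      if "1 \<le> y" for y
    proof -
      have "0 < y" using that by simp
      then show ?thesis
      proof (cases rule: predecessor_cases)
        case (power j)
        show ?thesis
        proof (cases j)
          case (Suc i)
          have "(2::nat) ^ i > 0" by simp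
          then have "top_power (y - 1) = 2 ^ i"
            unfolding Suc power(1) by (intro top_power_eqI) (simp_all del: zero_less_power)
          then show ?thesis
            using power Suc \<open>(2::nat) ^ i > 0\<close> by (auto simp del: zero_less_power)
        qed (use power in simp)
      qed (use \<open>0 < y\<close> in auto)
    qed
  qed
  show ?thesis if rec: "closed_bounded_rec2 K"
  proof (rule bounded_rec2_unary[OF rec _ id _ top_power_le])
    show "member 2 (\<lambda>xs. if xs ! 0 \<le> 1 then 1 else 2 * xs ! 1)"
      by (intro member_intros) auto
  qed (rule top_power_halve, simp)
qed

text \<open>
  Both schemes yield recursion along bit lengths: in the first scheme the value is updated at
  powers of two only, in the second one the orbit of \<open>y\<close> under halving visits every bit length
  below that of \<open>y\<close> once.
\<close>

lemma bit_length_rec: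
  assumes \<psi>: "member 2 (\<lambda>xs. \<psi> (xs ! 0) (xs ! 1))" and g: "g \<in> unary K" "mono g"
    and S: "\<And>j. S (Suc j) = \<psi> (2 ^ j) (S j)" "S 0 \<le> g 0" "\<And>j. S (Suc j) \<le> g (2 ^ j)"
  shows "(\<lambda>y. S (bit_length y)) \<in> unary K"
proof -
  have bound: "S (bit_length y) \<le> g y" for y
  proof (cases "y = 0")
    case False
    then have "0 < y"
      by simp
    then obtain j where "2 ^ j \<le> y" "bit_length y = Suc j"
      by (rule bit_length_pos)
    then show ?thesis
      using S(3)[of j] monoD[OF g(2), of "2 ^ j" y] by simp
  qed (use S in simp)
  show ?thesis
    using recursion
  proof
    show ?thesis if rec: "closed_bounded_rec K"
    proof (rule bounded_rec_unary[OF rec _ g(1) _ bound])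
      show "member 2 (\<lambda>xs. if top_power (xs ! 0) = xs ! 0 then \<psi> (xs ! 0) (xs ! 1) else xs ! 1)"
        by (intro member_intros member_comp2[where h = \<psi>, OF \<psi>] member_comp1[OF top_power_in_class]) auto
      show "S (bit_length y) = (if top_power y = y then \<psi> y (S (bit_length (y - 1)))
              else S (bit_length (y - 1)))" if "1 \<le> y" for y
      proof -
        have "0 < y" using that by simp
        then show ?thesis
          by (cases rule: predecessor_cases) (simp_all add: S(1) bit_length_power)
      qed
    qed
    show ?thesis if rec: "closed_bounded_rec2 K"
    proof (rule bounded_rec2_unary[OF rec _ g(1) _ bound])
      show "member 2 (\<lambda>xs. \<psi> (top_power (xs ! 0)) (xs ! 1))"
        by (intro member_comp2[where h = \<psi>, OF \<psi>] member_proj member_comp1[OF top_power_in_class]) auto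
      show "S (bit_length y) = \<psi> (top_power y) (S (bit_length (y div 2)))" if "1 \<le> y" for y
        using that by (subst bit_length.simps) (simp add: S(1) top_power_def bit_length.simps[of y])
    qed
  qed
qed

lemma bit_length_in_class: "bit_length \<in> unary K"
proof -
  have "(\<lambda>y. id (bit_length y)) \<in> unary K"
  proof (rule bit_length_rec)
    show "member 2 (\<lambda>xs. Suc (xs ! 1))"
      by (intro member_intros) auto
    show "Suc \<in> unary K"
      unfolding unary_iff by (intro member_intros) auto
    show "id (Suc j) \<le> Suc (2 ^ j)" for j :: nat
      using less_exp[of j] by simp
  qed (auto simp: mono_def)
  then show ?thesis
    by simp
qed

end

section \<open>Signed digit expansions\<close>

lemma digits_real_finite:
  assumes "\<And>u. N \<le> u \<Longrightarrow> f u = 1"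
  shows "digits_real f = (\<Sum>u<N. (real (f u) - 1) / 2 ^ (u + 1))"
  unfolding digits_real_def by (rule suminf_finite) (auto simp: assms not_less)

lemma digits_real_bounds:
  assumes f: "\<And>u. f u \<in> {1, 2}"
  shows "(\<Sum>u<N. (real (f u) - 1) / 2 ^ (u + 1)) \<le> digits_real f"
    and "digits_real f \<le> (\<Sum>u<N. (real (f u) - 1) / 2 ^ (u + 1)) + (1 / 2) ^ N"
proof -
  define d where "d u = (real (f u) - 1) / 2 ^ (u + 1)" for u
  have d: "0 \<le> d u" "d u \<le> (1 / 2) ^ Suc u" for u
    using f[of u] unfolding d_def by (auto simp: field_simps)
  have sd: "summable d"
    by (rule summable_comparison_test'[of "\<lambda>u. (1 / 2) ^ Suc u" 0])
       (use d in \<open>auto simp: summable_Suc_iff intro!: summable_mult summable_geometric\<close>)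
  have "digits_real f = (\<Sum>u. d (u + N)) + sum d {..<N}"
    unfolding digits_real_def d_def[symmetric] using sd by (rule suminf_split_initial_segment)
  moreover have "0 \<le> (\<Sum>u. d (u + N))"
    using d sd by (intro suminf_nonneg) (auto simp: summable_iff_shift)
  moreover have "(\<Sum>u. d (u + N)) \<le> (\<Sum>u. (1 / 2) ^ N * (1 / 2) ^ Suc u)"
  proof (rule suminf_le)
    show "d (u + N) \<le> (1 / 2) ^ N * (1 / 2) ^ Suc u" for u
      using d(2)[of "u + N"] by (simp add: power_add mult_ac)
    show "summable (\<lambda>u. d (u + N))"
      using sd by (simp add: summable_iff_shift)
    show "summable (\<lambda>u. (1 / 2 :: real) ^ N * (1 / 2) ^ Suc u)"
      by (intro summable_mult) (simp add: summable_geometric)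
  qed
  moreover have "(\<lambda>u. (1 / 2 :: real) ^ N * (1 / 2) ^ Suc u) sums ((1 / 2) ^ N * 1)"
    by (intro sums_mult power_half_series)
  ultimately show "(\<Sum>u<N. (real (f u) - 1) / 2 ^ (u + 1)) \<le> digits_real f"
    and "digits_real f \<le> (\<Sum>u<N. (real (f u) - 1) / 2 ^ (u + 1)) + (1 / 2) ^ N"
    unfolding d_def[symmetric] by (auto simp: sums_iff)
qed

context superposition_class
begin

lemma digits_real_generated:
  "f \<in> unary K \<Longrightarrow> range f \<subseteq> {0, 1, 2} \<Longrightarrow> digits_real f \<in> generated_reals K"
  unfolding generated_reals_def by (intro CollectI exI[of _ 0] exI[of _ f]) simp

lemma truncation_generated:
  assumes "f \<in> unary K" "range f \<subseteq> {0, 1, 2}"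
  shows "(\<Sum>u<N. (real (f u) - 1) / 2 ^ (u + 1)) \<in> generated_reals K"
proof -
  let ?f = "\<lambda>u. if N \<le> u then 1 else f u"
  have "?f \<in> unary K"
    using assms(1) unfolding unary_iff by (intro member_intros) auto
  moreover have "range ?f \<subseteq> {0, 1, 2}"
    using assms(2) unfolding image_subset_iff by simp
  ultimately have "digits_real ?f \<in> generated_reals K"
    by (rule digits_real_generated)
  moreover have "digits_real ?f = (\<Sum>u<N. (real (f u) - 1) / 2 ^ (u + 1))"
    by (subst digits_real_finite[of N]) auto
  ultimately show ?thesis
    by simp
qed

lemma zero_generated: "0 \<in> generated_reals K"
  using truncation_generated[of "\<lambda>_. 1" 0] by (simp add: unary_iff member_const)

lemma dyadic_generated: "(1 / 2) ^ Suc t \<in> generated_reals K"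
proof -
  let ?f = "\<lambda>u. if u = t then 2 else 1 :: nat"
  have "?f \<in> unary K"
    unfolding unary_iff by (intro member_intros) auto
  from truncation_generated[OF this, of "Suc t"] show ?thesis
    by (auto simp: power_divide)
qed

end

section \<open>The diagonal real\<close>

text \<open>
  A state \<open>pair (pair n i) t\<close> records that the requirements below \<open>n\<close> are settled, that the last digit
  of signed value 1 has position \<open>t\<close>, and that the digits before it sum up to \<open>\<mu> i\<close>. The partial sum
  that it stands for is the following real.
\<close>

definition state_real :: "(nat \<Rightarrow> real) \<Rightarrow> nat \<Rightarrow> real" where
  "state_real \<mu> s = \<mu> (snd_of (fst_of s)) + (1 / 2) ^ Suc (snd_of s)"

text \<open>
  A certificate \<open>pair s (pair i k)\<close> for the state \<open>s\<close> supplies an index \<open>i\<close> of the partial sum and a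
  precision \<open>k\<close> such that increasing the sum by a positive amount of at most \<open>2 ^ -(k + 1)\<close> results
  in a real different from \<open>\<mu> n\<close>, where \<open>n\<close> is the number of the requirement to be settled next.
  The components are read off by the projections, so that numbers that are not pairs are allowed.
\<close>

definition certificate :: "(nat \<Rightarrow> real) \<Rightarrow> nat \<Rightarrow> bool" where
  "certificate \<mu> m \<longleftrightarrow>
     \<mu> (fst_of (snd_of m)) = state_real \<mu> (fst_of m) \<and>
     (\<mu> (fst_of (fst_of (fst_of m))) \<le> \<mu> (fst_of (snd_of m)) \<or>
      \<mu> (fst_of (snd_of m)) + (1 / 2) ^ Suc (snd_of (snd_of m)) < \<mu> (fst_of (fst_of (fst_of m))))"

text \<open>
  The assumptions on \<open>G\<close> say that it lists the certificates, shifted by 1, each of them infinitely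
  often; the value 0 carries no information. They turn out to be contradictory.
\<close>

locale diagonalization = recursion_class +
  fixes \<mu> :: "nat \<Rightarrow> real" and G :: "nat \<Rightarrow> nat"
  assumes onto: "range \<mu> = generated_reals K"
    and G: "G \<in> unary K"
    and G_range: "range G \<subseteq> {0} \<union> {m + 1 | m. certificate \<mu> m}"
    and G_infinite: "certificate \<mu> m \<Longrightarrow> infinite (G -` {m + 1})"
begin

text \<open>
  At time \<open>y\<close> the certificate \<open>G (bit_length y) - 1\<close> is acted upon if it is one for the current state
  and \<open>G (bit_length y) \<le> y\<close>; the digit at position \<open>y\<close> is then the next one of signed value 1.
\<close>

definition move :: "nat \<Rightarrow> nat \<Rightarrow> nat" where
  "move y s =
     (let z = G (bit_length y) in
      if z = 0 then s
      else if fst_of (z - 1) = s then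
        if z \<le> y then pair (pair (Suc (fst_of (fst_of s))) (fst_of (snd_of (z - 1)))) y else s
      else s)"

text \<open>
  \<open>state j\<close> is the state before time \<open>2 ^ j\<close>. Position 0 always carries a digit of signed value 1, since
  the initial state has this position as its last component.
\<close>

primrec state :: "nat \<Rightarrow> nat" where
  "state 0 = pair (pair 0 (SOME i. \<mu> i = 0)) 0"
| "state (Suc j) = move (2 ^ j) (state j)"

text \<open>\<open>acts j\<close> means that a certificate is acted upon at time \<open>2 ^ j\<close>.\<close>

definition acts :: "nat \<Rightarrow> bool" where
  "acts j \<longleftrightarrow> (\<exists>m. G (Suc j) = Suc m \<and> fst_of m = state j \<and> Suc m \<le> 2 ^ j)"

lemma state_idle: "\<not> acts j \<Longrightarrow> state (Suc j) = state j"
  unfolding acts_def by (cases "G (Suc j)") (auto simp: move_def Let_def bit_length_power)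

lemma state_act:
  assumes "acts j"
  obtains m where "certificate \<mu> m" "fst_of m = state j" "Suc m \<le> 2 ^ j"
    "state (Suc j) = pair (pair (Suc (fst_of (fst_of (state j)))) (fst_of (snd_of m))) (2 ^ j)"
proof -
  obtain m where m: "G (Suc j) = Suc m" "fst_of m = state j" "Suc m \<le> 2 ^ j"
    using assms unfolding acts_def by blast
  have "Suc m \<in> range G"
    using m(1) by (metis rangeI)
  then have "certificate \<mu> m"
    using G_range by auto
  then show ?thesis
    using that m by (simp add: move_def bit_length_power)
qed

lemma state_bound: "state (Suc j) \<le> state 0 + pair (pair (Suc (2 ^ j)) (2 ^ j)) (2 ^ j)"
proof (induction j)
  have act: "state (Suc j) \<le> state 0 + pair (pair (Suc (2 ^ j)) (2 ^ j)) (2 ^ j)" if j: "acts j" for j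
  proof -
    obtain m where m: "fst_of m = state j" "Suc m \<le> 2 ^ j"
      "state (Suc j) = pair (pair (Suc (fst_of (fst_of (state j)))) (fst_of (snd_of m))) (2 ^ j)"
      using j by (rule state_act)
    have "fst_of (fst_of (state j)) \<le> m"
      using fst_of_le m(1) by (metis dual_order.trans)
    moreover have "fst_of (snd_of m) \<le> m"
      using fst_of_le snd_of_le by (metis dual_order.trans)
    ultimately have "state (Suc j) \<le> pair (pair (Suc (2 ^ j)) (2 ^ j)) (2 ^ j)"
      unfolding m(3) using m(2) by (intro pair_mono) auto
    then show ?thesis
      by simp
  qed
  {
    case 0
    show ?case
      using act[of 0] state_idle[of 0] by (cases "acts 0") auto
  next
    case (Suc j)
    have "pair (pair (Suc (2 ^ j)) (2 ^ j)) (2 ^ j)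
        \<le> pair (pair (Suc (2 ^ Suc j)) (2 ^ Suc j)) (2 ^ Suc j)"
      by (intro pair_mono) auto
    then show ?case
      using act[of "Suc j"] state_idle[of "Suc j"] Suc by (cases "acts (Suc j)") (auto simp del: state.simps)
  }
qed

lemma state_in_class: "(\<lambda>y. state (bit_length y)) \<in> unary K"
proof (rule bit_length_rec)
  show "member 2 (\<lambda>xs. move (xs ! 0) (xs ! 1))"
    unfolding move_def Let_def
    by (intro member_intros member_comp1[OF G] member_comp1[OF bit_length_in_class]) auto
  show "(\<lambda>y. state 0 + pair (pair (Suc y) y) y) \<in> unary K"
    unfolding unary_iff by (intro member_intros) auto
  show "mono (\<lambda>y. state 0 + pair (pair (Suc y) y) y)"
    by (intro monoI add_left_mono pair_mono) auto
qed (use state_bound in \<open>simp_all del: state.simps(1)\<close>)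

text \<open>
  The state in force right after time \<open>y\<close> has \<open>y\<close> as the position of the last digit of signed value 1
  exactly if the digit at \<open>y\<close> is to be such a digit.
\<close>

definition digit :: "nat \<Rightarrow> nat" where
  "digit y = (if snd_of (state (bit_length y)) = y then 2 else 1)"

lemma digit_in_class: "digit \<in> unary K"
  unfolding unary_iff digit_def
  by (intro member_intros member_comp1[OF state_in_class]) auto

lemma digit_range: "digit y \<in> {1, 2}"
  unfolding digit_def by simp

lemma snd_of_state: "snd_of (state j) < 2 ^ j"
proof (induction j)
  case (Suc j)
  show ?case
  proof (cases "acts j")
    case True
    then show ?thesis
      by (rule state_act) (simp del: state.simps)
  qed (use Suc state_idle[of j] in \<open>simp del: state.simps\<close>)
qed simp

lemma digit_act: "acts j \<Longrightarrow> digit (2 ^ j) = 2"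
  unfolding digit_def bit_length_power by (erule state_act) (simp del: state.simps)

lemma digit_else:
  assumes y: "2 ^ j \<le> y" "y < 2 ^ Suc j" and "acts j \<Longrightarrow> y \<noteq> 2 ^ j"
  shows "digit y = 1"
proof (cases "acts j")
  case True
  then have "snd_of (state (Suc j)) = 2 ^ j"
    by (rule state_act) (simp del: state.simps)
  then show ?thesis
    using assms True unfolding digit_def bit_length_eqI[OF y] by simp
next
  case False
  then show ?thesis
    using snd_of_state[of j] y state_idle[OF False] unfolding digit_def bit_length_eqI[OF y]
    by (simp del: state.simps)
qed

text \<open>The partial sum of the digits at the positions below \<open>2 ^ j\<close>.\<close>

definition partial :: "nat \<Rightarrow> real" where
  "partial j = (\<Sum>u<2 ^ j. (real (digit u) - 1) / 2 ^ (u + 1))"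

lemma partial_Suc: "partial (Suc j) = partial j + (if acts j then (1 / 2) ^ Suc (2 ^ j) else 0)"
proof -
  let ?d = "\<lambda>u. (real (digit u) - 1) / 2 ^ (u + 1)"
  have "partial (Suc j) = partial j + sum ?d {2 ^ j..<2 ^ Suc j}"
    unfolding partial_def lessThan_atLeast0 by (rule sum.atLeastLessThan_concat[symmetric]) auto
  also have "sum ?d {2 ^ j..<2 ^ Suc j} = ?d (2 ^ j) + sum ?d {Suc (2 ^ j)..<2 ^ Suc j}"
    by (rule sum.atLeast_Suc_lessThan) simp
  also have "sum ?d {Suc (2 ^ j)..<2 ^ Suc j} = 0"
    by (rule sum.neutral) (auto simp: digit_else[of j])
  also have "?d (2 ^ j) = (if acts j then (1 / 2) ^ Suc (2 ^ j) else 0)"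
    using digit_act[of j] digit_else[of j "2 ^ j"] by (auto simp: power_divide)
  finally show ?thesis
    by simp
qed

lemma partial_eq: "partial j = state_real \<mu> (state j)"
proof (induction j)
  case 0
  have "\<exists>i. \<mu> i = 0"
    using zero_generated onto by (metis imageE)
  then have "\<mu> (SOME i. \<mu> i = 0) = 0"
    by (rule someI_ex)
  then show ?case
    by (simp add: partial_def state_real_def digit_def)
next
  case (Suc j)
  show ?case
  proof (cases "acts j")
    case True
    then obtain m where m: "certificate \<mu> m" "fst_of m = state j"
      "state (Suc j) = pair (pair (Suc (fst_of (fst_of (state j)))) (fst_of (snd_of m))) (2 ^ j)"
      by (rule state_act)
    show ?thesis
      using True m(1) Suc unfolding partial_Suc m(3) certificate_def m(2) by (simp add: state_real_def)
  qed (simp add: partial_Suc Suc state_idle del: state.simps)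
qed

text \<open>
  If no action took place from \<open>j0\<close> on, the state would remain the same. Its partial sum is a finite
  digit expansion, hence has a \<open>\<mu>\<close>-index, so there is a certificate for this state; it recurs in \<open>G\<close>
  at a time that exceeds its code.
\<close>

lemma acts_unboundedly: "\<exists>j\<ge>j0. acts j"
proof (rule ccontr)
  assume "\<not> ?thesis"
  then have idle: "\<not> acts j" if "j0 \<le> j" for j
    using that by blast
  have const: "state j = state j0" if "j0 \<le> j" for j
    using that by (induction j rule: dec_induct) (simp_all add: state_idle idle del: state.simps)
  define n where "n = fst_of (fst_of (state j0))"
  have "partial j0 \<in> generated_reals K"
    unfolding partial_def using digit_in_class digit_range by (intro truncation_generated) blast+
  then obtain i where i: "\<mu> i = state_real \<mu> (state j0)"
    using onto partial_eq by (metis imageE)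
  obtain k where k: "\<mu> n \<le> \<mu> i \<or> \<mu> i + (1 / 2) ^ Suc k < \<mu> n"
  proof (cases "\<mu> n \<le> \<mu> i")
    case False
    then obtain k where "(1 / 2) ^ k < \<mu> n - \<mu> i"
      using real_arch_pow_inv[of "\<mu> n - \<mu> i" "1 / 2"] by auto
    moreover have "(1 / 2 :: real) ^ Suc k \<le> (1 / 2) ^ k"
      by simp
    ultimately show ?thesis
      using that by (metis add.commute less_diff_eq order_le_less_trans)
  qed blast
  define m where "m = pair (state j0) (pair i k)"
  have "certificate \<mu> m"
    unfolding certificate_def m_def using i k by (simp add: n_def)
  then have "infinite (G -` {m + 1})"
    by (rule G_infinite)
  then obtain u where u: "u > j0 + m" "G u = m + 1"
    unfolding finite_nat_set_iff_bounded_le by (auto simp: not_le)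
  then obtain j where j: "u = Suc j"
    by (cases u) auto
  have "Suc m \<le> 2 ^ j"
    using u j less_exp[of j] by linarith
  then have "acts j"
    unfolding acts_def using u j const[of j] by (auto simp: m_def)
  then show False
    using idle u j by simp
qed

lemma next_act:
  obtains j' where "j \<le> j'" "acts j'" "state j' = state j"
proof -
  define j' where "j' = (LEAST j'. j \<le> j' \<and> acts j')"
  have j': "j \<le> j'" "acts j'"
    using LeastI_ex[of "\<lambda>j'. j \<le> j' \<and> acts j'"] acts_unboundedly[of j] unfolding j'_def by auto
  have idle: "\<not> acts u" if "j \<le> u" "u < j'" for u
    using that not_less_Least[of u "\<lambda>j'. j \<le> j' \<and> acts j'"] unfolding j'_def by blast
  have "state u = state j" if "j \<le> u" "u \<le> j'" for u
    using that by (induction u rule: dec_induct) (simp_all add: state_idle idle del: state.simps)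
  then show ?thesis
    using that j' by blast
qed

lemma act_on_requirement: "\<exists>j. acts j \<and> fst_of (fst_of (state j)) = n"
proof (induction n)
  case 0
  show ?case
    by (rule next_act[of 0]) auto
next
  case (Suc n)
  then obtain j where "acts j" "fst_of (fst_of (state j)) = n"
    by blast
  then have "fst_of (fst_of (state (Suc j))) = Suc n"
    by (elim state_act) (simp del: state.simps)
  then show ?case
    by (metis next_act)
qed

lemma diagonal_real_new: "digits_real digit \<noteq> \<mu> n"
proof -
  obtain j where j: "acts j" "fst_of (fst_of (state j)) = n"
    using act_on_requirement by blast
  obtain m where m: "certificate \<mu> m" "fst_of m = state j" "Suc m \<le> 2 ^ j"
    using j(1) by (rule state_act)
  define i k where "i = fst_of (snd_of m)" and "k = snd_of (snd_of m)"
  have i: "\<mu> i = partial j" and k: "\<mu> n \<le> partial j \<or> partial j + (1 / 2) ^ Suc k < \<mu> n"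
    using m(1) j(2) unfolding certificate_def m(2) partial_eq[symmetric] i_def[symmetric] k_def[symmetric]
    by auto
  have "partial j < partial (Suc j)"
    using j(1) by (simp add: partial_Suc)
  also have "partial (Suc j) \<le> digits_real digit"
    unfolding partial_def by (rule digits_real_bounds) (rule digit_range)
  finally have "partial j < digits_real digit" .
  moreover have "digits_real digit \<le> partial j + (1 / 2) ^ (2 ^ j)"
    unfolding partial_def by (rule digits_real_bounds) (rule digit_range)
  moreover have "Suc k \<le> 2 ^ j"
    using m(3) snd_of_le[of m] snd_of_le[of "snd_of m"] unfolding k_def by simp
  \<comment> \<open>\<open>k \<le> m\<close>, and the code \<open>m\<close> is below the time of the action\<close>
  then have "(1 / 2 :: real) ^ (2 ^ j) \<le> (1 / 2) ^ Suc k"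
    by (intro power_decreasing) auto
  ultimately show ?thesis
    using k by linarith
qed

lemma inconsistent: False
proof -
  have "digits_real digit \<in> generated_reals K"
    using digit_in_class digit_range by (intro digits_real_generated) blast+
  then show False
    using onto diagonal_real_new by (metis imageE)
qed

end

section \<open>Certificates are decidable\<close>

text \<open>
  The reals \<open>2 ^ -(t + 1)\<close> have a computable sequence of \<open>\<mu>\<close>-indices, found by searching for halves, and
  order is expressed through the two relations of the structure.
\<close>

lemma (in superposition_class) certificate_decidable:
  assumes K: "computable_class K" and \<mu>: "computable_presentation (real_struct K) \<mu>"
  shows "decidable 1 (\<lambda>xs. certificate \<mu> (xs ! 0))"
proof -
  have onto: "range \<mu> = generated_reals K"
    using \<mu> unfolding computable_presentation_def real_struct_def by simp
  have le: "decidable 3 (\<lambda>xs. \<mu> (xs ! 0) + \<mu> (xs ! 1) \<le> \<mu> (xs ! 2))"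
    and ge: "decidable 3 (\<lambda>xs. \<mu> (xs ! 2) \<le> \<mu> (xs ! 0) + \<mu> (xs ! 1))"
    using \<mu> unfolding computable_presentation_def real_struct_def decidable_def
    by (auto intro: computable_cong[rotated] simp: tuples_def)
  note le = decidable_comp3[of "\<lambda>a b c. \<mu> a + \<mu> b \<le> \<mu> c", OF le]
  note ge = decidable_comp3[of "\<lambda>a b c. \<mu> c \<le> \<mu> a + \<mu> b", OF ge]
  obtain z where z: "\<mu> z = 0"
    using zero_generated onto by (metis imageE)
  define R where "R i v \<longleftrightarrow> \<mu> i + \<mu> i \<le> \<mu> v \<and> \<mu> v \<le> \<mu> i + \<mu> i" for i v
  obtain c where c: "\<mu> c = (1 / 2) ^ Suc 0"
    using dyadic_generated onto by (metis imageE)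
  define p where "p = rec_nat c (\<lambda>_ v. LEAST i. R i v)"
  have R_ex: "\<exists>i. R i v" if "\<mu> v = (1 / 2) ^ Suc t" for v t
  proof -
    obtain i where "\<mu> i = (1 / 2) ^ Suc (Suc t)"
      using dyadic_generated onto by (metis imageE)
    then show ?thesis
      using that unfolding R_def by (intro exI[of _ i]) simp
  qed
  have p: "\<mu> (p t) = (1 / 2) ^ Suc t" for t
  proof (induction t)
    case (Suc t)
    have "R (p (Suc t)) (p t)"
      using LeastI_ex[OF R_ex[OF Suc]] by (simp add: p_def)
    then show ?case
      using Suc unfolding R_def by simp
  qed (simp add: p_def c)
  have comp_p: "computable 1 (\<lambda>xs. p (xs ! 0))"
  proof (rule computable_iterated_search)
    show "decidable 2 (\<lambda>xs. R (xs ! 0) (xs ! 1))"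
      unfolding R_def by (intro decidable_conj le ge computable_proj) auto
    show "\<exists>i. R i (p t)" for t
      using R_ex[OF p] .
  qed (simp_all add: p_def)
  define s i k n where "s = (\<lambda>xs :: nat list. fst_of (xs ! 0))"
    and "i = (\<lambda>xs :: nat list. fst_of (snd_of (xs ! 0)))"
    and "k = (\<lambda>xs :: nat list. snd_of (snd_of (xs ! 0)))"
    and "n = (\<lambda>xs :: nat list. fst_of (fst_of (fst_of (xs ! 0))))"
  have comp: "computable 1 i" "computable 1 k" "computable 1 n"
    "computable 1 (\<lambda>xs. snd_of (fst_of (s xs)))" "computable 1 (\<lambda>xs. snd_of (s xs))"
    unfolding s_def i_def k_def n_def
    by (rule member_imp_computable[OF K], intro member_intros, simp)+
  have "decidable 1 (\<lambda>xs.
      (\<mu> (snd_of (fst_of (s xs))) + \<mu> (p (snd_of (s xs))) \<le> \<mu> (i xs) \<and>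
       \<mu> (i xs) \<le> \<mu> (snd_of (fst_of (s xs))) + \<mu> (p (snd_of (s xs)))) \<and>
      (\<mu> (n xs) + \<mu> z \<le> \<mu> (i xs) \<or> \<not> \<mu> (n xs) \<le> \<mu> (i xs) + \<mu> (p (k xs))))"
    by (intro decidable_conj decidable_disj decidable_not le ge comp computable_const
        computable_comp1[OF comp_p])
  moreover have "(\<lambda>xs.
      (\<mu> (snd_of (fst_of (s xs))) + \<mu> (p (snd_of (s xs))) \<le> \<mu> (i xs) \<and>
       \<mu> (i xs) \<le> \<mu> (snd_of (fst_of (s xs))) + \<mu> (p (snd_of (s xs)))) \<and>
      (\<mu> (n xs) + \<mu> z \<le> \<mu> (i xs) \<or> \<not> \<mu> (n xs) \<le> \<mu> (i xs) + \<mu> (p (k xs))))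
    = (\<lambda>xs. certificate \<mu> (xs ! 0))"
    unfolding certificate_def state_real_def s_def i_def k_def n_def by (rule ext) (auto simp: p z)
  ultimately show ?thesis
    by simp
qed

theorem theorem3:
  fixes K :: "nat \<Rightarrow> (nat list \<Rightarrow> nat) set"
    and F :: "nat \<Rightarrow> nat \<Rightarrow> nat"
  assumes "computable_class K"
    and "contains_basic K"
    and "computable 2 (lift2 F)" and "range F = unary K"
    and "\<exists>H. computable 1 (lift1 H) \<and>
           (\<forall>n. range (F (H n)) = {0} \<union> {x + 1 | x. x \<in> W n} \<and>
                (\<forall>i\<in>W n. infinite (F (H n) -` {i + 1})))"
    and "closed_superposition K"
    and "closed_bounded_rec K \<or> closed_bounded_rec2 K"
  shows "\<not> (\<exists>\<mu>. computable_presentation (real_struct K) \<mu>)"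
proof
  assume "\<exists>\<mu>. computable_presentation (real_struct K) \<mu>"
  then obtain \<mu> where \<mu>: "computable_presentation (real_struct K) \<mu>" ..
  interpret recursion_class K
    by unfold_locales (fact assms)+
  obtain e where e: "W e = {m. certificate \<mu> m}"
    using decidable_imp_W[OF certificate_decidable[OF assms(1) \<mu>]] by blast
  obtain H where "\<forall>n. range (F (H n)) = {0} \<union> {x + 1 | x. x \<in> W n} \<and>
      (\<forall>i\<in>W n. infinite (F (H n) -` {i + 1}))"
    using assms(5) by (elim exE conjE)
  then have H: "range (F (H e)) = {0} \<union> {x + 1 | x. certificate \<mu> x}"
      "\<And>i. certificate \<mu> i \<Longrightarrow> infinite (F (H e) -` {i + 1})"
    using e by simp_all
  interpret diagonalization K \<mu> "F (H e)"
  proof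
    show "range \<mu> = generated_reals K"
      using \<mu> unfolding computable_presentation_def real_struct_def by simp
    show "F (H e) \<in> unary K"
      using assms(4) by blast
  qed (use H in simp_all)
  show False
    by (rule inconsistent)
qed

end
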